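(* Let $X$ be a graph realizing the degree sequence $d$, with $\deg(X)=k\le 3$. Then the realization graph $\mathcal{G}(d)$ is regular if and only if neither $T_{221}$ nor $\overline{T_{221}}$ is (isomorphic to) an induced subgraph of $X$; and in that case $d$ is unigraphical, $\mathcal{G}(d)$ is vertex-transitive and $k$-regular, and $\tau(X)\approx X$ for every 2-switch $\tau$ on $X$.
   Context: Graphs are finite and simple, with nonempty vertex set; $\approx$ is isomorphism and $\overline{G}$ is the complement of $G$. A 2-switch $\tau$ on $G$: given four distinct vertices $a,b,x,y$ with $ab,xy\in E(G)$ and $ax,by\notin E(G)$, delete the edges $ab,xy$ and add the edges $ax,by$; the resulting graph is $\tau(G)$ (two 2-switches are equal iff they delete the same two edges and add the same two edges). The 2-switch-degree $\deg(G)$ is the number of distinct 2-switches that can be performed on $G$. For a degree sequence $d=(d_1,\dots,d_n)$, the realization graph $\mathcal{G}(d)$ has as vertices all labeled graphs on the vertex set $\{1,\dots,n\}$ in which vertex $i$ has degree $d_i$ for every $i$, two of them being adjacent iff one is obtained from the other by a single 2-switch. The sequence $d$ is unigraphical if all its realizations are isomorphic. $T_{221}$ is the split graph with clique $\{1,2,3\}$ and independent set $\{a,b,c\}$ with neighborhoods $N_a=\{2\}$, $N_b=\{1,3\}$, $N_c=\{2,3\}$. *)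

theory Defs
  imports Main
begin

section \<open>Finite simple graphs\<close>

type_synonym 'a sgraph = "'a set \<times> 'a set set"

abbreviation verts :: "'a sgraph \<Rightarrow> 'a set" where
  "verts G \<equiv> fst G"

abbreviation edges :: "'a sgraph \<Rightarrow> 'a set set" where
  "edges G \<equiv> snd G"

definition simple_graph :: "'a sgraph \<Rightarrow> bool" where
  "simple_graph G \<longleftrightarrow>
     finite (verts G) \<and> verts G \<noteq> {} \<and> (\<forall>e\<in>edges G. e \<subseteq> verts G \<and> card e = 2)"

definition complement_graph :: "'a sgraph \<Rightarrow> 'a sgraph" where
  "complement_graph G = (verts G, {e. e \<subseteq> verts G \<and> card e = 2 \<and> e \<notin> edges G})"

definition degree :: "'a sgraph \<Rightarrow> 'a \<Rightarrow> nat" where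
  "degree G v = card {e \<in> edges G. v \<in> e}"

definition graph_iso :: "('a \<Rightarrow> 'b) \<Rightarrow> 'a sgraph \<Rightarrow> 'b sgraph \<Rightarrow> bool" where
  "graph_iso f G H \<longleftrightarrow>
     bij_betw f (verts G) (verts H) \<and>
     (\<forall>u\<in>verts G. \<forall>v\<in>verts G. {u, v} \<in> edges G \<longleftrightarrow> {f u, f v} \<in> edges H)"

definition graph_isomorphic :: "'a sgraph \<Rightarrow> 'b sgraph \<Rightarrow> bool" where
  "graph_isomorphic G H \<longleftrightarrow> (\<exists>f. graph_iso f G H)"

definition induced_subgraph :: "'a sgraph \<Rightarrow> 'a set \<Rightarrow> 'a sgraph" where
  "induced_subgraph G S = (S, {e \<in> edges G. e \<subseteq> S})"

definition has_induced :: "'a sgraph \<Rightarrow> 'b sgraph \<Rightarrow> bool" where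
  "has_induced G H \<longleftrightarrow> (\<exists>S \<subseteq> verts G. graph_isomorphic H (induced_subgraph G S))"

definition k_regular :: "nat \<Rightarrow> 'a sgraph \<Rightarrow> bool" where
  "k_regular k G \<longleftrightarrow> (\<forall>v\<in>verts G. degree G v = k)"

definition regular_graph :: "'a sgraph \<Rightarrow> bool" where
  "regular_graph G \<longleftrightarrow> (\<exists>k. k_regular k G)"

definition vertex_transitive :: "'a sgraph \<Rightarrow> bool" where
  "vertex_transitive G \<longleftrightarrow> (\<forall>u\<in>verts G. \<forall>v\<in>verts G. \<exists>f. graph_iso f G G \<and> f u = v)"


section \<open>2-switches\<close>

text \<open>A 2-switch is identified with the pair (set of deleted edges, set of added edges), so that
  different quadruples (a, b, x, y) describing the same exchange of edges count once.\<close>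

definition two_switches :: "'a sgraph \<Rightarrow> ('a set set \<times> 'a set set) set" where
  "two_switches G =
     {({{a, b}, {x, y}}, {{a, x}, {b, y}}) | a b x y.
        distinct [a, b, x, y] \<and>
        {a, b} \<in> edges G \<and> {x, y} \<in> edges G \<and> {a, x} \<notin> edges G \<and> {b, y} \<notin> edges G}"

definition apply_switch :: "'a set set \<times> 'a set set \<Rightarrow> 'a sgraph \<Rightarrow> 'a sgraph" where
  "apply_switch \<tau> G = (verts G, (edges G - fst \<tau>) \<union> snd \<tau>)"

definition switch_degree :: "'a sgraph \<Rightarrow> nat" where
  "switch_degree G = card (two_switches G)"


section \<open>Degree sequences and realization graphs\<close>

text \<open>The entry \<open>d\<^sub>i\<close> of a degree sequence (i = 1, ..., n) is \<open>d ! (i - 1)\<close>. A graph on an arbitrary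
  vertex set realizes d if its vertices can be numbered so that the i-th one has degree \<open>d\<^sub>i\<close>;
  the labeled realizations below are those on the vertex set {1, ..., n} numbered by the
  identity.\<close>

definition realizes :: "'a sgraph \<Rightarrow> nat list \<Rightarrow> bool" where
  "realizes G d \<longleftrightarrow>
     simple_graph G \<and>
     (\<exists>f. bij_betw f {1..length d} (verts G) \<and>
          (\<forall>i\<in>{1..length d}. degree G (f i) = d ! (i - 1)))"

definition labeled_realizations :: "nat list \<Rightarrow> nat sgraph set" where
  "labeled_realizations d =
     {G. simple_graph G \<and> verts G = {1..length d} \<and>
         (\<forall>i\<in>{1..length d}. degree G i = d ! (i - 1))}"

definition realization_graph :: "nat list \<Rightarrow> nat sgraph sgraph" where
  "realization_graph d =
     (labeled_realizations d,
      {{G, H} | G H. G \<in> labeled_realizations d \<and> H \<in> labeled_realizations d \<and>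
                     (\<exists>\<tau>\<in>two_switches G. H = apply_switch \<tau> G)})"

text \<open>Every finite graph has an isomorphic copy with vertices in \<^typ>\<open>nat\<close>, so quantifying over
  graphs of that vertex type covers all realizations.\<close>

definition unigraphical :: "nat list \<Rightarrow> bool" where
  "unigraphical d \<longleftrightarrow>
     (\<forall>(G :: nat sgraph) (H :: nat sgraph).
        realizes G d \<and> realizes H d \<longrightarrow> graph_isomorphic G H)"


section \<open>The split graph \<open>T\<^sub>2\<^sub>2\<^sub>1\<close>\<close>

text \<open>The independent vertices a, b, c are 4, 5, 6.\<close>

definition T221 :: "nat sgraph" where
  "T221 = ({1, 2, 3, 4, 5, 6},
           {{1, 2}, {1, 3}, {2, 3},
            {4, 2},
            {5, 1}, {5, 3},
            {6, 2}, {6, 3}})"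

end

theory Submission
  imports Defs "HOL-Combinatorics.Permutations"
begin

text \<open>
Let \<open>(a, b, x, y)\<close> describe a switch: \<open>ab\<close>, \<open>xy\<close> are deleted and \<open>ax\<close>, \<open>by\<close> are added. If every
other vertex sees \<open>b\<close> and \<open>x\<close> alike, then transposing \<open>b\<close> and \<open>x\<close> maps the switched graph back to the
original one; the same works for \<open>a\<close> and \<open>y\<close>. So the switch can change the isomorphism type only if
some vertex \<open>v\<close> distinguishes \<open>b\<close> from \<open>x\<close> and some vertex \<open>w\<close> distinguishes \<open>a\<close> from \<open>y\<close>. Each
of \<open>v\<close> and \<open>w\<close> gives rise to one further switch, and a short case analysis (\<open>split_both_sides\<close>)
finds a fourth one unless the six vertices induce \<open>T\<^sub>2\<^sub>2\<^sub>1\<close> or its complement. Complementation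
exchanges the two outcomes, because it turns the switch \<open>(a, b, x, y)\<close> into \<open>(a, x, b, y)\<close>. Hence in a
graph with at most three switches and neither of the two induced subgraphs, no switch changes the
isomorphism type (\<open>apply_switch_isomorphic\<close>).

Any two labelled realizations of a degree sequence are joined by a chain of switches
(\<open>switch_connected\<close>). Therefore, if \<open>X\<close> avoids the two graphs, every realization is isomorphic to \<open>X\<close>.
A vertex of the realization graph has as degree the number of its switches, an isomorphism
invariant, so the realization graph is \<open>k\<close>-regular. An isomorphism between two labelled realizations
permutes the labels and preserves the prescribed degrees; relabelling all realizations by this
permutation is an automorphism of the realization graph, which is therefore vertex-transitive.

Conversely, if \<open>X\<close> contains one of the two graphs, a suitable switch inside it produces a
realization with at least four switches, while \<open>X\<close> has at most three. So the realization graph has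
vertices of different degrees.
\<close>

section \<open>Adjacency\<close>

definition adj :: "'a sgraph \<Rightarrow> 'a \<Rightarrow> 'a \<Rightarrow> bool" where
  "adj G u v \<longleftrightarrow> {u, v} \<in> edges G"

lemma adj_commute: "adj G u v \<longleftrightarrow> adj G v u"
  by (simp add: adj_def insert_commute)

lemma adjD:
  assumes "simple_graph G" "adj G u v"
  shows "u \<in> verts G" "v \<in> verts G" "u \<noteq> v"
  using assms by (force simp: simple_graph_def adj_def)+

lemma adj_irrefl: "simple_graph G \<Longrightarrow> \<not> adj G u u"
  using adjD(3) by fastforce

lemma finite_edges: "simple_graph G \<Longrightarrow> finite (edges G)"
  by (rule finite_subset[of _ "Pow (verts G)"]) (auto simp: simple_graph_def)

lemma edge_obtain_adj:
  assumes "simple_graph G" "e \<in> edges G"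
  obtains u v where "e = {u, v}" "u \<noteq> v" "adj G u v"
proof -
  have "card e = 2" using assms by (auto simp: simple_graph_def)
  then obtain u v where "e = {u, v}" "u \<noteq> v" by (auto simp: card_2_iff)
  with assms(2) show thesis by (intro that[of u v]) (auto simp: adj_def)
qed

lemma graph_eqI:
  assumes "simple_graph G" "simple_graph H" "verts G = verts H"
    and "\<And>u v. adj G u v \<longleftrightarrow> adj H u v"
  shows "G = H"
proof -
  have "edges G = edges H"
    using assms(4) by (auto elim!: edge_obtain_adj[OF assms(1)] edge_obtain_adj[OF assms(2)] simp: adj_def)
  with assms(3) show ?thesis by (simp add: prod_eq_iff)
qed

lemma degree_eq_card_neighbours:
  assumes "simple_graph G"
  shows "degree G v = card {u. adj G v u}"
proof -
  have "{e \<in> edges G. v \<in> e} = (\<lambda>u. {v, u}) ` {u. adj G v u}"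
    by (auto simp: adj_def insert_commute elim!: edge_obtain_adj[OF assms])
  moreover have "inj_on (\<lambda>u. {v, u}) {u. adj G v u}"
    by (auto simp: inj_on_def doubleton_eq_iff)
  ultimately show ?thesis by (simp add: degree_def card_image)
qed

lemma finite_neighbours: "simple_graph G \<Longrightarrow> finite {u. adj G v u}"
  by (rule finite_subset[of _ "verts G"]) (auto dest: adjD(2), simp add: simple_graph_def)

section \<open>Switches as quadruples\<close>

text \<open>A switch is handled through the quadruple \<open>(a, b, x, y)\<close> that produces it. The quadruple is determined
by the switch only up to the four symmetries generated by \<open>(b, a, y, x)\<close> and \<open>(y, x, b, a)\<close>, which
serve below to reduce the number of cases.\<close>

definition switchable :: "'a sgraph \<Rightarrow> 'a \<Rightarrow> 'a \<Rightarrow> 'a \<Rightarrow> 'a \<Rightarrow> bool" where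
  "switchable G a b x y \<longleftrightarrow>
     distinct [a, b, x, y] \<and> adj G a b \<and> adj G x y \<and> \<not> adj G a x \<and> \<not> adj G b y"

definition switch_pair :: "'a \<Rightarrow> 'a \<Rightarrow> 'a \<Rightarrow> 'a \<Rightarrow> 'a set set \<times> 'a set set" where
  "switch_pair a b x y = ({{a, b}, {x, y}}, {{a, x}, {b, y}})"

lemma two_switches_eq:
  "two_switches G = {switch_pair a b x y | a b x y. switchable G a b x y}"
  by (simp add: two_switches_def switch_pair_def switchable_def adj_def)

lemma two_switchesE:
  assumes "\<tau> \<in> two_switches G"
  obtains a b x y where "\<tau> = switch_pair a b x y" "switchable G a b x y"
  using assms by (auto simp: two_switches_eq)

lemma switch_pair_mem: "switchable G a b x y \<Longrightarrow> switch_pair a b x y \<in> two_switches G"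
  by (auto simp: two_switches_eq)

lemma finite_two_switches:
  assumes "simple_graph G"
  shows "finite (two_switches G)"
proof (rule finite_subset)
  show "two_switches G \<subseteq> Pow (edges G) \<times> Pow (Pow (verts G))"
    using adjD[OF assms] by (auto elim!: two_switchesE simp: switch_pair_def switchable_def adj_def)
  show "finite (Pow (edges G) \<times> Pow (Pow (verts G)))"
    using assms by (simp add: finite_edges simple_graph_def)
qed

lemma four_le_switch_degree:
  assumes "simple_graph G"
    and "switchable G a1 b1 x1 y1" "switchable G a2 b2 x2 y2"
    and "switchable G a3 b3 x3 y3" "switchable G a4 b4 x4 y4"
    and "distinct [switch_pair a1 b1 x1 y1, switch_pair a2 b2 x2 y2,
                   switch_pair a3 b3 x3 y3, switch_pair a4 b4 x4 y4]"
  shows "4 \<le> switch_degree G"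
proof -
  let ?ts = "[switch_pair a1 b1 x1 y1, switch_pair a2 b2 x2 y2,
              switch_pair a3 b3 x3 y3, switch_pair a4 b4 x4 y4]"
  have "card (set ?ts) = 4" using distinct_card[OF assms(6)] by simp
  moreover have "card (set ?ts) \<le> card (two_switches G)"
    using assms by (intro card_mono finite_two_switches) (auto simp: switch_pair_mem)
  ultimately show ?thesis by (simp add: switch_degree_def)
qed

lemma switchable_sym:
  assumes "switchable G a b x y"
  shows "switchable G b a y x" "switchable G y x b a"
  using assms by (auto simp: switchable_def adj_commute)

lemma switch_pair_sym:
  "switch_pair b a y x = switch_pair a b x y" "switch_pair y x b a = switch_pair a b x y"
  by (auto simp: switch_pair_def insert_commute)

lemma verts_apply_switch [simp]: "verts (apply_switch \<tau> G) = verts G"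
  by (simp add: apply_switch_def)

lemma adj_apply_switch:
  "adj (apply_switch (switch_pair a b x y) G) u v \<longleftrightarrow>
     {u, v} = {a, x} \<or> {u, v} = {b, y} \<or>
     adj G u v \<and> {u, v} \<noteq> {a, b} \<and> {u, v} \<noteq> {x, y}"
  by (auto simp: adj_def apply_switch_def switch_pair_def)

lemma simple_apply_switch:
  assumes "simple_graph G" "\<tau> \<in> two_switches G"
  shows "simple_graph (apply_switch \<tau> G)"
  using assms(2)
proof (rule two_switchesE)
  fix a b x y assume *: "\<tau> = switch_pair a b x y" "switchable G a b x y"
  have "{a, b, x, y} \<subseteq> verts G" using adjD[OF assms(1)] *(2) by (auto simp: switchable_def)
  with assms(1) * show ?thesis
    by (auto simp: simple_graph_def apply_switch_def switch_pair_def switchable_def)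
qed

text \<open>A switch is undone by the switch that deletes what was added; this makes the adjacency of the
realization graph symmetric.\<close>

lemma apply_switch_inverse:
  assumes "switchable G a b x y"
  shows "switchable (apply_switch (switch_pair a b x y) G) a x b y"
    "apply_switch (switch_pair a x b y) (apply_switch (switch_pair a b x y) G) = G"
  using assms
   apply (auto simp: switchable_def adj_apply_switch doubleton_eq_iff)[1]
  using assms
  apply (auto simp: switchable_def adj_def apply_switch_def switch_pair_def prod_eq_iff doubleton_eq_iff)
  done

text \<open>Each of the four vertices loses exactly one edge and gains exactly one.\<close>

lemma degree_apply_switch:
  assumes "simple_graph G" "\<tau> \<in> two_switches G"
  shows "degree (apply_switch \<tau> G) v = degree G v"
  using assms(2)
proof (rule two_switchesE)
  fix a b x y assume \<tau>: "\<tau> = switch_pair a b x y" and sw: "switchable G a b x y"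
  define E where "E = {e \<in> edges G. v \<in> e}"
  define D where "D = {e \<in> {{a, b}, {x, y}}. v \<in> e}"
  define A where "A = {e \<in> {{a, x}, {b, y}}. v \<in> e}"
  have "{e \<in> edges (apply_switch \<tau> G). v \<in> e} = (E - D) \<union> A"
    by (auto simp: \<tau> apply_switch_def switch_pair_def D_def A_def E_def)
  moreover have "card D = card A"
  proof -
    have "D = (if v = a \<or> v = b then {{a, b}} else if v = x \<or> v = y then {{x, y}} else {})"
      "A = (if v = a \<or> v = x then {{a, x}} else if v = b \<or> v = y then {{b, y}} else {})"
      using sw by (auto simp: D_def A_def switchable_def)
    then show ?thesis by auto
  qed
  moreover have "D \<subseteq> E" "A \<inter> E = {}"
    using sw by (auto simp: D_def A_def E_def switchable_def adj_def)
  moreover have "finite E" "finite A" "finite D"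
    using finite_edges[OF assms(1)] by (auto simp: A_def D_def E_def)
  ultimately have "card {e \<in> edges (apply_switch \<tau> G). v \<in> e} = card E - card D + card A"
    by (simp add: card_Un_disjoint card_Diff_subset Int_Diff Int_commute inf.absorb_iff2 disjoint_iff)
  moreover have "card D \<le> card E" using \<open>finite E\<close> \<open>D \<subseteq> E\<close> by (rule card_mono)
  ultimately show ?thesis using \<open>card D = card A\<close> by (simp add: degree_def E_def)
qed

section \<open>Complementation\<close>

lemma simple_complement: "simple_graph G \<Longrightarrow> simple_graph (complement_graph G)"
  by (auto simp: simple_graph_def complement_graph_def)

lemma adj_complement:
  "adj (complement_graph G) u v \<longleftrightarrow> u \<in> verts G \<and> v \<in> verts G \<and> u \<noteq> v \<and> \<not> adj G u v"
  by (auto simp: adj_def complement_graph_def card_2_iff doubleton_eq_iff)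

lemma verts_complement [simp]: "verts (complement_graph G) = verts G"
  by (simp add: complement_graph_def)

lemma complement_complement:
  assumes "simple_graph G"
  shows "complement_graph (complement_graph G) = G"
  using assms by (intro graph_eqI simple_complement) (auto simp: adj_complement dest: adjD)

text \<open>In the complement the added pairs become the deleted ones, so the roles of \<open>b\<close> and \<open>x\<close> are
exchanged.\<close>

lemma switchable_complement:
  assumes "simple_graph G" "switchable G a b x y"
  shows "switchable (complement_graph G) a x b y"
  using assms adjD[OF assms(1)] by (auto simp: switchable_def adj_complement)

lemma switch_degree_complement_le:
  assumes "simple_graph G"
  shows "switch_degree (complement_graph G) \<le> switch_degree G"
proof -
  have "two_switches (complement_graph G) \<subseteq> prod.swap ` two_switches G"
  proof
    fix \<tau> assume "\<tau> \<in> two_switches (complement_graph G)"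
    then obtain a b x y
      where \<tau>: "\<tau> = switch_pair a b x y" "switchable (complement_graph G) a b x y"
      by (rule two_switchesE)
    from switchable_complement[OF simple_complement[OF assms] \<tau>(2)]
    have "switch_pair a x b y \<in> two_switches G"
      by (simp add: complement_complement assms switch_pair_mem)
    moreover have "\<tau> = prod.swap (switch_pair a x b y)" by (simp add: \<tau> switch_pair_def)
    ultimately show "\<tau> \<in> prod.swap ` two_switches G" by blast
  qed
  then show ?thesis
    unfolding switch_degree_def
    by (meson assms card_image_le card_mono finite_imageI finite_two_switches order_trans)
qed

lemma switch_degree_complement:
  assumes "simple_graph G"
  shows "switch_degree (complement_graph G) = switch_degree G"
  using switch_degree_complement_le[OF assms] switch_degree_complement_le[OF simple_complement[OF assms]]
  by (simp add: complement_complement assms)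

section \<open>Isomorphisms\<close>

lemma graph_iso_adj:
  "graph_iso f G H \<Longrightarrow> u \<in> verts G \<Longrightarrow> v \<in> verts G \<Longrightarrow> adj H (f u) (f v) \<longleftrightarrow> adj G u v"
  by (simp add: graph_iso_def adj_def)

lemma graph_isoI:
  assumes "bij_betw f (verts G) (verts H)"
    and "\<And>u v. u \<in> verts G \<Longrightarrow> v \<in> verts G \<Longrightarrow> adj H (f u) (f v) \<longleftrightarrow> adj G u v"
  shows "graph_iso f G H"
  using assms by (simp add: graph_iso_def adj_def)

lemma graph_iso_mem: "graph_iso f G H \<Longrightarrow> u \<in> verts G \<Longrightarrow> f u \<in> verts H"
  by (auto simp: graph_iso_def bij_betw_def)

lemma graph_iso_inj:
  "graph_iso f G H \<Longrightarrow> u \<in> verts G \<Longrightarrow> v \<in> verts G \<Longrightarrow> f u = f v \<longleftrightarrow> u = v"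
  by (auto simp: graph_iso_def bij_betw_def inj_on_def)

lemma graph_isomorphic_refl: "graph_isomorphic G G"
  by (auto simp: graph_isomorphic_def intro!: exI[of _ id] graph_isoI)

lemma graph_isomorphic_sym:
  assumes "graph_isomorphic G H"
  shows "graph_isomorphic H G"
proof -
  obtain f where f: "graph_iso f G H" using assms by (auto simp: graph_isomorphic_def)
  then have bij: "bij_betw f (verts G) (verts H)" by (simp add: graph_iso_def)
  have "graph_iso (inv_into (verts G) f) H G"
  proof (rule graph_isoI)
    show "bij_betw (inv_into (verts G) f) (verts H) (verts G)" using bij by (rule bij_betw_inv_into)
    fix u v assume "u \<in> verts H" "v \<in> verts H"
    with bij have "inv_into (verts G) f u \<in> verts G" "f (inv_into (verts G) f u) = u"
      "inv_into (verts G) f v \<in> verts G" "f (inv_into (verts G) f v) = v"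
      by (simp_all add: bij_betw_def inv_into_into f_inv_into_f)
    with graph_iso_adj[OF f] show "adj G (inv_into (verts G) f u) (inv_into (verts G) f v) \<longleftrightarrow> adj H u v"
      by metis
  qed
  then show ?thesis by (auto simp: graph_isomorphic_def)
qed

lemma graph_isomorphic_trans:
  assumes "graph_isomorphic G H" "graph_isomorphic H K"
  shows "graph_isomorphic G K"
proof -
  obtain f g where f: "graph_iso f G H" and g: "graph_iso g H K"
    using assms by (auto simp: graph_isomorphic_def)
  have "graph_iso (g \<circ> f) G K"
    using f g graph_iso_adj[OF f] graph_iso_adj[OF g] graph_iso_mem[OF f]
    by (intro graph_isoI) (auto simp: graph_iso_def intro: bij_betw_trans)
  then show ?thesis by (auto simp: graph_isomorphic_def)
qed

lemma degree_graph_iso: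
  assumes "simple_graph G" "simple_graph H" "graph_iso f G H" "v \<in> verts G"
  shows "degree H (f v) = degree G v"
proof -
  have "bij_betw f {u. adj G v u} {u. adj H (f v) u}"
    unfolding bij_betw_def
  proof
    show "inj_on f {u. adj G v u}"
      using adjD(2)[OF assms(1)] graph_iso_inj[OF assms(3)] by (auto simp: inj_on_def)
    show "f ` {u. adj G v u} = {u. adj H (f v) u}"
    proof (intro equalityI subsetI)
      fix u assume "u \<in> {u. adj H (f v) u}"
      then have u: "adj H (f v) u" "u \<in> verts H" using adjD(2)[OF assms(2)] by auto
      then obtain u' where "u' \<in> verts G" "u = f u'"
        using assms(3) unfolding graph_iso_def bij_betw_def by blast
      with u graph_iso_adj[OF assms(3,4)] show "u \<in> f ` {u. adj G v u}" by auto
    qed (use adjD(2)[OF assms(1)] graph_iso_adj[OF assms(3,4)] in auto)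
  qed
  then show ?thesis by (simp add: degree_eq_card_neighbours assms bij_betw_same_card)
qed

lemma switch_degree_le_if_isomorphic:
  assumes "simple_graph G" "simple_graph H" "graph_isomorphic G H"
  shows "switch_degree H \<le> switch_degree G"
proof -
  obtain f where f: "graph_iso f G H" using assms by (auto simp: graph_isomorphic_def)
  let ?F = "map_prod ((`) ((`) f)) ((`) ((`) f))"
  have "two_switches H \<subseteq> ?F ` two_switches G"
  proof
    fix \<tau> assume "\<tau> \<in> two_switches H"
    then obtain a b x y where \<tau>: "\<tau> = switch_pair a b x y" "switchable H a b x y"
      by (rule two_switchesE)
    then have "{a, b, x, y} \<subseteq> f ` verts G"
      using adjD[OF assms(2)] f by (auto simp: switchable_def graph_iso_def bij_betw_def)
    then obtain a' b' x' y' where *: "{a', b', x', y'} \<subseteq> verts G"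
      "a = f a'" "b = f b'" "x = f x'" "y = f y'" by auto
    with \<tau>(2) have "switchable G a' b' x' y'"
      by (auto simp: switchable_def graph_iso_adj[OF f])
    moreover have "\<tau> = ?F (switch_pair a' b' x' y')" by (simp add: \<tau> * switch_pair_def)
    ultimately show "\<tau> \<in> ?F ` two_switches G" by (metis image_eqI switch_pair_mem)
  qed
  then show ?thesis
    unfolding switch_degree_def
    by (meson assms(1) card_image_le card_mono finite_imageI finite_two_switches order_trans)
qed

lemma switch_degree_isomorphic:
  assumes "simple_graph G" "simple_graph H" "graph_isomorphic G H"
  shows "switch_degree G = switch_degree H"
  using assms switch_degree_le_if_isomorphic graph_isomorphic_sym by (metis order_antisym)

text \<open>Working with embeddings instead of vertex subsets makes transport along isomorphisms and
complementation a matter of composing maps.\<close>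

lemma has_induced_iff:
  "has_induced G K \<longleftrightarrow>
    (\<exists>f. inj_on f (verts K) \<and> f ` verts K \<subseteq> verts G \<and>
         (\<forall>u\<in>verts K. \<forall>v\<in>verts K. adj G (f u) (f v) \<longleftrightarrow> adj K u v))" (is "_ \<longleftrightarrow> (\<exists>f. ?emb f)")
proof
  assume "has_induced G K"
  then obtain S f where "S \<subseteq> verts G" "graph_iso f K (induced_subgraph G S)"
    by (auto simp: has_induced_def graph_isomorphic_def)
  then have "?emb f"
    by (simp add: graph_iso_def induced_subgraph_def bij_betw_def adj_def) blast
  then show "\<exists>f. ?emb f" by blast
next
  assume "\<exists>f. ?emb f"
  then obtain f where "?emb f" by blast
  then have "graph_iso f K (induced_subgraph G (f ` verts K))"
    by (simp add: graph_iso_def induced_subgraph_def bij_betw_def adj_def)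
  with \<open>?emb f\<close> show "has_induced G K"
    unfolding has_induced_def graph_isomorphic_def by blast
qed

lemma has_induced_isomorphic:
  assumes "graph_isomorphic G H" "has_induced G K"
  shows "has_induced H K"
proof -
  obtain g where g: "graph_iso g G H" using assms by (auto simp: graph_isomorphic_def)
  obtain f where f: "inj_on f (verts K)" "f ` verts K \<subseteq> verts G"
    "\<forall>u\<in>verts K. \<forall>v\<in>verts K. adj G (f u) (f v) \<longleftrightarrow> adj K u v"
    using assms by (auto simp: has_induced_iff)
  have "inj_on (g \<circ> f) (verts K)"
    using f g by (intro comp_inj_on) (auto simp: graph_iso_def bij_betw_def intro: inj_on_subset)
  then show ?thesis unfolding has_induced_iff
    using f graph_iso_adj[OF g] graph_iso_mem[OF g] by (intro exI[of _ "g \<circ> f"]) (auto simp: image_subset_iff)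
qed

lemma has_induced_complement:
  assumes "simple_graph G" "simple_graph K" "has_induced (complement_graph G) (complement_graph K)"
  shows "has_induced G K"
proof -
  obtain f where "inj_on f (verts K)" "f ` verts K \<subseteq> verts G"
    "\<forall>u\<in>verts K. \<forall>v\<in>verts K. adj (complement_graph G) (f u) (f v) \<longleftrightarrow> adj (complement_graph K) u v"
    using assms by (auto simp: has_induced_iff simple_complement)
  then show ?thesis unfolding has_induced_iff
    using adj_irrefl[OF assms(1)] adj_irrefl[OF assms(2)]
    by (intro exI[of _ f]) (auto simp: adj_complement inj_on_def image_subset_iff, metis+)
qed

lemma simple_T221: "simple_graph T221"
  by (auto simp: simple_graph_def T221_def)

section \<open>Switches that preserve the isomorphism type\<close>

text \<open>The transposition of \<open>b\<close> and \<open>x\<close> carries the edges \<open>ab\<close>, \<open>xy\<close> to \<open>ax\<close>, \<open>by\<close> and fixes the pairs \<open>bx\<close>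
and \<open>ay\<close>, whatever their status; the remaining vertices do not notice it.\<close>

lemma apply_switch_isomorphic_if_twins:
  assumes G: "simple_graph G" and sw: "switchable G a b x y"
    and twins: "\<And>v. v \<notin> {a, b, x, y} \<Longrightarrow> adj G v b \<longleftrightarrow> adj G v x"
  shows "graph_isomorphic (apply_switch (switch_pair a b x y) G) G"
proof -
  have V: "b \<in> verts G" "x \<in> verts G" using sw adjD[OF G] by (auto simp: switchable_def)
  have "adj G (transpose b x u) (transpose b x v) \<longleftrightarrow>
        adj (apply_switch (switch_pair a b x y) G) u v" for u v
  proof -
    \<comment> \<open>Only pairs meeting \<open>{b, x}\<close> in one vertex move; their other end \<open>z\<close> is one of \<open>a\<close>, \<open>y\<close>, or an
      outside vertex, for which the twin hypothesis applies.\<close>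
    consider "u = v" | "u \<noteq> v" "{u, v} \<inter> {b, x} = {}" | "{u, v} = {b, x}"
      | w z where "{u, v} = {w, z}" "w \<in> {b, x}" "z \<in> {a, y}"
      | w z where "{u, v} = {w, z}" "w \<in> {b, x}" "z \<notin> {a, b, x, y}"
      by (cases "u \<in> {b, x}"; cases "v \<in> {b, x}") auto
    then show ?thesis
    proof cases
      case 1
      then show ?thesis using sw adj_irrefl[OF G] by (auto simp: adj_apply_switch switchable_def)
    next
      case 2
      then show ?thesis using sw by (auto simp: adj_apply_switch switchable_def doubleton_eq_iff)
    next
      case 3
      then show ?thesis using sw
        by (auto simp: adj_apply_switch switchable_def doubleton_eq_iff adj_commute)
    next
      case 4
      then show ?thesis using sw
        by (auto simp: adj_apply_switch switchable_def doubleton_eq_iff adj_commute)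
    next
      case 5
      then show ?thesis using sw twins[of z]
        by (auto simp: adj_apply_switch switchable_def doubleton_eq_iff adj_commute)
    qed
  qed
  then have "graph_iso (transpose b x) (apply_switch (switch_pair a b x y) G) G"
    using V by (intro graph_isoI) (simp_all add: permutes_imp_bij permutes_swap_id)
  then show ?thesis by (auto simp: graph_isomorphic_def)
qed

lemma complement_T221I:
  assumes G: "simple_graph G" and "distinct [p1, p2, p3, p4, p5, p6]"
    and "adj G p1 p4" "adj G p1 p6" "adj G p2 p5" "adj G p3 p4"
      "adj G p4 p5" "adj G p4 p6" "adj G p5 p6"
    and "\<not> adj G p1 p2" "\<not> adj G p1 p3" "\<not> adj G p1 p5" "\<not> adj G p2 p3" "\<not> adj G p2 p4"
      "\<not> adj G p2 p6" "\<not> adj G p3 p5" "\<not> adj G p3 p6"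
  shows "has_induced G (complement_graph T221)"
proof -
  define f :: "nat \<Rightarrow> 'a"
    where "f i = (if i = 1 then p1 else if i = 2 then p2 else if i = 3 then p3
             else if i = 4 then p4 else if i = 5 then p5 else p6)" for i
  have "{p1, p2, p3, p4, p5, p6} \<subseteq> verts G"
    using assms adjD[OF G] by auto
  moreover have "inj_on f (verts T221)"
    using assms(2) by (auto simp: T221_def f_def inj_on_def)
  moreover have "\<forall>u\<in>verts T221. \<forall>v\<in>verts T221. adj G (f u) (f v) \<longleftrightarrow> adj (complement_graph T221) u v"
    using assms(2-) adj_irrefl[OF G] unfolding adj_complement
    by (simp add: T221_def f_def adj_def doubleton_eq_iff insert_commute)
  ultimately show ?thesis
    unfolding has_induced_iff by (intro exI[of _ f]) (auto simp: T221_def f_def)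
qed

lemma switch_pair_eq_iff:
  assumes "distinct [a, b, x, y]"
  shows "switch_pair p q r s = switch_pair a b x y \<longleftrightarrow>
    (p, q, r, s) \<in> {(a, b, x, y), (b, a, y, x), (x, y, a, b), (y, x, b, a)}"
  using assms by (auto simp: switch_pair_def doubleton_eq_iff)

text \<open>The case analysis at the heart of the proof. Besides the given switch \<open>(a, b, x, y)\<close> there are
\<open>(v, b, x, y)\<close> and \<open>(a, w, x, y)\<close>, so the bound on the number of switches forbids any fourth one.
Every adjacency not fixed by the hypotheses is then decided by exhibiting the switch that the
wrong choice would create. The four vertices \<open>a, b, x, y\<close> cannot induce a 4-cycle or two disjoint
edges, so they induce a path, either \<open>b - a - y - x\<close> or \<open>a - b - x - y\<close>; in both cases the six
vertices turn out to induce the complement of \<open>T\<^sub>2\<^sub>2\<^sub>1\<close>.\<close>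

lemma split_both_sides:
  assumes G: "simple_graph G" and deg: "switch_degree G \<le> 3"
    and sw: "switchable G a b x y"
    and v: "v \<notin> {a, b, x, y}" "adj G v b" "\<not> adj G v x"
    and w: "w \<notin> {a, b, x, y}" "adj G w a" "\<not> adj G w y"
  shows "has_induced G (complement_graph T221)"
proof -
  have edges: "adj G a b" "adj G x y" "\<not> adj G a x" "\<not> adj G b y" and dist: "distinct [a, b, x, y]"
    using sw by (auto simp: switchable_def)
  have sw_v: "switchable G v b x y" and sw_w: "switchable G a w x y"
    using edges dist v w by (auto simp: switchable_def adj_commute)
  have three: "distinct [switch_pair a b x y, switch_pair v b x y, switch_pair a w x y]"
    using dist v w by (auto simp: switch_pair_eq_iff)
  have no_fourth: "\<not> switchable G p q r s"
    if "switch_pair p q r s \<notin> {switch_pair a b x y, switch_pair v b x y, switch_pair a w x y}"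
    for p q r s
    using four_le_switch_degree[OF G sw sw_v sw_w, of p q r s] three that deg by force
  note defs = switchable_def switch_pair_eq_iff adj_commute
  have not_C4: "\<not> (adj G a y \<and> adj G b x)"
    using no_fourth[of b x y a] edges dist v w by (auto simp: defs)
  have not_2K2: "adj G a y \<or> adj G b x"
    using no_fourth[of a b y x] edges dist v w by (auto simp: defs)
  \<comment> \<open>A single vertex distinguishing both pairs yields a fourth switch together with
    whichever of \<open>ay\<close>, \<open>bx\<close> is missing.\<close>
  have "v \<noteq> w"
  proof
    assume "v = w"
    show False
    proof (cases "adj G a y")
      case True
      then show False using not_C4 no_fourth[of v b y x] edges dist v w \<open>v = w\<close> by (auto simp: defs)
    next
      case False
      then show False using no_fourth[of a v y x] edges dist v w \<open>v = w\<close> by (auto simp: defs)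
    qed
  qed
  have "\<not> adj G v w"
    using no_fourth[of v w x y] edges dist v w \<open>v \<noteq> w\<close> by (auto simp: defs)
  show ?thesis
  proof (cases "adj G a y")
    case True
    have va: "adj G v a" using True no_fourth[of v b a y] edges dist v w \<open>v \<noteq> w\<close> by (auto simp: defs)
    have vy: "adj G v y" using va no_fourth[of a v x y] edges dist v w \<open>v \<noteq> w\<close> by (auto simp: defs)
    have wx: "\<not> adj G w x" using True no_fourth[of w x y a] edges dist v w \<open>v \<noteq> w\<close> by (auto simp: defs)
    have wb: "\<not> adj G w b" using wx no_fourth[of w b x y] edges dist v w \<open>v \<noteq> w\<close> by (auto simp: defs)
    \<comment> \<open>Clique \<open>a, y, v\<close> and independent set \<open>b, x, w\<close> with neighbourhoods \<open>{a, v}\<close>, \<open>{y}\<close>, \<open>{a}\<close>.\<close>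
    show ?thesis
      using True va vy wx wb not_C4 edges dist v w \<open>v \<noteq> w\<close> \<open>\<not> adj G v w\<close>
      by (intro complement_T221I[OF G, of b x w a y v]) (auto simp: adj_commute)
  next
    case False
    with not_2K2 have bx: "adj G b x" by simp
    have wb: "adj G w b" using bx no_fourth[of w a b x] edges dist v w \<open>v \<noteq> w\<close> by (auto simp: defs)
    have wx: "adj G w x" using wb no_fourth[of w b x y] edges dist v w \<open>v \<noteq> w\<close> by (auto simp: defs)
    have vy: "\<not> adj G v y" using bx no_fourth[of v y x b] edges dist v w \<open>v \<noteq> w\<close> by (auto simp: defs)
    have va: "\<not> adj G v a" using vy no_fourth[of v a y x] edges dist v w \<open>v \<noteq> w\<close> by (auto simp: defs)
    \<comment> \<open>The mirror image: \<open>a\<close> and \<open>b\<close>, \<open>x\<close> and \<open>y\<close>, \<open>v\<close> and \<open>w\<close> have exchanged their roles.\<close>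
    show ?thesis
      using False bx va vy wx wb edges dist v w \<open>v \<noteq> w\<close> \<open>\<not> adj G v w\<close>
      by (intro complement_T221I[OF G, of a y v b x w]) (auto simp: adj_commute)
  qed
qed

text \<open>If neither pair of opposite vertices consists of twins, there are vertices \<open>v\<close> and \<open>w\<close> as in
\<open>split_both_sides\<close>, up to which end each of them prefers. Reversing the quadruple flips both
preferences at once; passing to the complement flips that of \<open>w\<close> alone and produces \<open>T\<^sub>2\<^sub>2\<^sub>1\<close> instead of
its complement.\<close>

lemma apply_switch_isomorphic:
  assumes G: "simple_graph G" and deg: "switch_degree G \<le> 3"
    and T: "\<not> has_induced G T221" and coT: "\<not> has_induced G (complement_graph T221)"
    and \<tau>: "\<tau> \<in> two_switches G"
  shows "graph_isomorphic (apply_switch \<tau> G) G"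
proof -
  obtain a b x y where \<tau>_eq: "\<tau> = switch_pair a b x y" and sw: "switchable G a b x y"
    using \<tau> by (rule two_switchesE)
  have V: "{a, b, x, y} \<subseteq> verts G" using sw adjD[OF G] by (auto simp: switchable_def)
  let ?C = "complement_graph G"
  note split_complement =
    split_both_sides[OF simple_complement[OF G] _ switchable_complement[OF G],
      unfolded switch_degree_complement[OF G], OF deg, THEN has_induced_complement[OF G simple_T221]]
  have "(\<forall>v. v \<notin> {a, b, x, y} \<longrightarrow> (adj G v b \<longleftrightarrow> adj G v x)) \<or>
        (\<forall>w. w \<notin> {a, b, x, y} \<longrightarrow> (adj G w a \<longleftrightarrow> adj G w y))"
  proof (rule ccontr)
    assume "\<not> ?thesis"
    then obtain v w where v: "v \<notin> {a, b, x, y}" "adj G v b \<noteq> adj G v x"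
      and w: "w \<notin> {a, b, x, y}" "adj G w a \<noteq> adj G w y" by blast
    then have vw: "v \<in> verts G" "w \<in> verts G" using adjD(1)[OF G] by blast+
    consider "adj G v b" "\<not> adj G v x" "adj G w a" "\<not> adj G w y"
      | "adj G v x" "\<not> adj G v b" "adj G w y" "\<not> adj G w a"
      | "adj G v b" "\<not> adj G v x" "adj G w y" "\<not> adj G w a"
      | "adj G v x" "\<not> adj G v b" "adj G w a" "\<not> adj G w y"
      using v(2) w(2) by blast
    then show False
    proof cases
      case 1
      then show False using split_both_sides[OF G deg sw] v w coT by blast
    next
      case 2
      then show False using split_both_sides[OF G deg switchable_sym(2)[OF sw], of v w] v w coT by blast
    next
      case 3
      then show False using split_complement[OF sw, of v w] v w vw V T
        by (auto simp: adj_complement)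
    next
      case 4
      then show False using split_complement[OF switchable_sym(2)[OF sw], of v w] v w vw V T
        by (auto simp: adj_complement)
    qed
  qed
  then show ?thesis
  proof
    assume "\<forall>v. v \<notin> {a, b, x, y} \<longrightarrow> (adj G v b \<longleftrightarrow> adj G v x)"
    then show ?thesis unfolding \<tau>_eq by (intro apply_switch_isomorphic_if_twins[OF G sw]) blast
  next
    assume *: "\<forall>w. w \<notin> {a, b, x, y} \<longrightarrow> (adj G w a \<longleftrightarrow> adj G w y)"
    show ?thesis unfolding \<tau>_eq switch_pair_sym(1)[of b a y x, symmetric]
      using * by (intro apply_switch_isomorphic_if_twins[OF G switchable_sym(1)[OF sw]]) blast
  qed
qed

section \<open>The graph \<open>T\<^sub>2\<^sub>2\<^sub>1\<close> forces an additional switch\<close>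

lemma adj_T221:
  "adj T221 i j \<longleftrightarrow> {i, j} \<in> {{1, 2}, {1, 3}, {2, 3}, {4, 2}, {5, 1}, {5, 3}, {6, 2}, {6, 3}}"
  by (simp add: adj_def T221_def)

lemma verts_T221: "verts T221 = {1, 2, 3, 4, 5, 6}"
  by (simp add: T221_def)

text \<open>\<open>T\<^sub>2\<^sub>2\<^sub>1\<close> has three switches. Replacing the edges \<open>42\<close>, \<open>51\<close> by \<open>41\<close>, \<open>52\<close> makes the neighbourhoods of the
independent vertices \<open>4\<close>, \<open>5\<close>, \<open>6\<close> in the clique equal to \<open>{1}\<close>, \<open>{2, 3}\<close>, \<open>{2, 3}\<close>. Now \<open>4\<close> can
exchange its neighbour \<open>1\<close> with either neighbour of \<open>5\<close> or of \<open>6\<close>, which are four switches.\<close>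

lemma T221_switch_increases_degree:
  assumes G: "simple_graph G" and T: "has_induced G T221"
  shows "\<exists>\<tau>\<in>two_switches G. 4 \<le> switch_degree (apply_switch \<tau> G)"
proof -
  obtain f where f: "inj_on f (verts T221)"
      "\<forall>u\<in>verts T221. \<forall>v\<in>verts T221. adj G (f u) (f v) \<longleftrightarrow> adj T221 u v"
    using T by (auto simp: has_induced_iff)
  have dist: "f i = f j \<longleftrightarrow> i = j" if "i \<in> verts T221" "j \<in> verts T221" for i j
    using f(1) that by (auto dest: inj_onD)
  have adj: "adj G (f i) (f j) \<longleftrightarrow> adj T221 i j" if "i \<in> verts T221" "j \<in> verts T221" for i j
    using f(2) that by blast
  note facts = dist adj adj_T221 verts_T221 doubleton_eq_iff
  have sw: "switchable G (f 4) (f 2) (f 1) (f 5)"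
    by (simp add: switchable_def facts)
  let ?\<tau> = "switch_pair (f 4) (f 2) (f 1) (f 5)"
  have new: "switchable (apply_switch ?\<tau> G) (f t) (f s) (f 1) (f 4)"
    if "t \<in> {5, 6}" "s \<in> {2, 3}" for t s
    using that by (auto simp: switchable_def adj_apply_switch facts)
  have "4 \<le> switch_degree (apply_switch ?\<tau> G)"
    by (rule four_le_switch_degree[OF simple_apply_switch[OF G switch_pair_mem[OF sw]]
          new[of 5 2] new[of 5 3] new[of 6 2] new[of 6 3]])
      (simp_all add: switch_pair_def facts)
  with switch_pair_mem[OF sw] show ?thesis by blast
qed

text \<open>In the complement of \<open>T\<^sub>2\<^sub>2\<^sub>1\<close> the clique is \<open>4, 5, 6\<close> and the vertices \<open>1\<close>, \<open>2\<close>, \<open>3\<close> have the neighbourhoods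
\<open>{4, 6}\<close>, \<open>{5}\<close>, \<open>{4}\<close>. Replacing \<open>14\<close>, \<open>52\<close> by \<open>15\<close>, \<open>42\<close> turns them into \<open>{5, 6}\<close>, \<open>{4}\<close>, \<open>{4}\<close>, and
either neighbour of \<open>1\<close> can be exchanged with the neighbour \<open>4\<close> of \<open>2\<close> or of \<open>3\<close>.\<close>

lemma complement_T221_switch_increases_degree:
  assumes G: "simple_graph G" and T: "has_induced G (complement_graph T221)"
  shows "\<exists>\<tau>\<in>two_switches G. 4 \<le> switch_degree (apply_switch \<tau> G)"
proof -
  obtain f where f: "inj_on f (verts T221)"
      "\<forall>u\<in>verts T221. \<forall>v\<in>verts T221. adj G (f u) (f v) \<longleftrightarrow> adj (complement_graph T221) u v"
    using T by (auto simp: has_induced_iff)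
  have dist: "f i = f j \<longleftrightarrow> i = j" if "i \<in> verts T221" "j \<in> verts T221" for i j
    using f(1) that by (auto dest: inj_onD)
  have adj: "adj G (f i) (f j) \<longleftrightarrow> i \<noteq> j \<and> \<not> adj T221 i j"
    if "i \<in> verts T221" "j \<in> verts T221" for i j
    using f(2) that by (simp add: adj_complement)
  note facts = dist adj adj_T221 verts_T221 doubleton_eq_iff
  have sw: "switchable G (f 1) (f 4) (f 5) (f 2)"
    by (simp add: switchable_def facts)
  let ?\<tau> = "switch_pair (f 1) (f 4) (f 5) (f 2)"
  have new: "switchable (apply_switch ?\<tau> G) (f 1) (f s) (f 4) (f t)"
    if "s \<in> {5, 6}" "t \<in> {2, 3}" for t s
    using that by (auto simp: switchable_def adj_apply_switch facts)
  have "4 \<le> switch_degree (apply_switch ?\<tau> G)"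
    by (rule four_le_switch_degree[OF simple_apply_switch[OF G switch_pair_mem[OF sw]]
          new[of 5 2] new[of 5 3] new[of 6 2] new[of 6 3]])
      (simp_all add: switch_pair_def facts)
  with switch_pair_mem[OF sw] show ?thesis by blast
qed

section \<open>Graphs with equal degrees are connected by switches\<close>

definition switch_step :: "'a sgraph \<Rightarrow> 'a sgraph \<Rightarrow> bool" where
  "switch_step G H \<longleftrightarrow> (\<exists>\<tau>\<in>two_switches G. H = apply_switch \<tau> G)"

lemma switch_step_sym: "switch_step G H \<Longrightarrow> switch_step H G"
  unfolding switch_step_def
  by (metis apply_switch_inverse switch_pair_mem two_switchesE)

text \<open>The Havel-Hakimi exchange: the neighbour \<open>u\<close> of \<open>v\<close> can be traded for the non-neighbour \<open>w\<close> if \<open>w\<close> has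
within \<open>U\<close> at least as many neighbours as \<open>u\<close>. For \<open>v\<close> is a neighbour of \<open>u\<close> only, so \<open>w\<close> must have a
neighbour \<open>z\<close> in \<open>U\<close> that \<open>u\<close> lacks. Keeping \<open>z\<close> in \<open>U\<close> leaves all edges at vertices outside \<open>U\<close>
untouched.\<close>

lemma switch_step_towards:
  assumes G: "simple_graph G" and U: "finite U" "v \<in> U" "u \<in> U" "w \<in> U"
    and u: "adj G v u" and w: "\<not> adj G v w" "w \<noteq> v"
    and le: "card {z \<in> U. adj G u z} \<le> card {z \<in> U. adj G w z}"
  shows "\<exists>z\<in>U. switchable G v u w z"
proof -
  have "\<exists>z \<in> U. adj G w z \<and> \<not> adj G u z \<and> z \<noteq> u"
  proof (rule ccontr)
    assume none: "\<not> ?thesis"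
    \<comment> \<open>The vertices \<open>u\<close> and \<open>w\<close> are removed since they may be adjacent to each other; by symmetry this
      costs both sides the same.\<close>
    let ?Nu = "{z \<in> U. adj G u z}" and ?Nw = "{z \<in> U. adj G w z}"
    have "card (?Nw - {u}) < card (?Nu - {w})"
    proof (rule psubset_card_mono)
      have "v \<in> ?Nu - {w}" "v \<notin> ?Nw" using u w U by (auto simp: adj_commute)
      then show "?Nw - {u} \<subset> ?Nu - {w}" using none adjD(3)[OF G] by blast
    qed (use U in simp)
    moreover have "u \<in> ?Nw \<longleftrightarrow> w \<in> ?Nu"
      using U by (simp add: adj_commute)
    ultimately show False using le U
      by (auto simp: card_Diff_singleton_if split: if_splits)
  qed
  then show ?thesis using u w adjD(3)[OF G] by (fastforce simp: switchable_def adj_commute)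
qed

text \<open>In that exchange \<open>p\<close> and \<open>q\<close>, on whose adjacency to \<open>v\<close> the graphs \<open>A\<close> and \<open>B\<close> disagree, are both
corrected, while no other adjacency of \<open>v\<close> changes.\<close>

lemma switch_step_closer:
  assumes A: "simple_graph A" and U: "finite U" "v \<in> U" "p \<in> U" "q \<in> U"
    and p: "adj A v p" "\<not> adj B v p" and q: "\<not> adj A v q" "adj B v q" "q \<noteq> v"
    and le: "card {z \<in> U. adj A p z} \<le> card {z \<in> U. adj A q z}"
  obtains K where "switch_step A K" "simple_graph K" "verts K = verts A"
    "\<And>t. degree K t = degree A t" "\<And>s t. s \<notin> U \<Longrightarrow> adj K s t \<longleftrightarrow> adj A s t"
    "{t. adj K v t \<noteq> adj B v t} \<subset> {t. adj A v t \<noteq> adj B v t}"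
proof -
  obtain z where z: "z \<in> U" "switchable A v p q z"
    using switch_step_towards[OF A U p(1) q(1,3) le] by blast
  let ?K = "apply_switch (switch_pair v p q z) A"
  show thesis
  proof (rule that[of ?K])
    show "switch_step A ?K" using z by (auto simp: switch_step_def switch_pair_mem)
    show "simple_graph ?K" "degree ?K t = degree A t" for t
      using z A by (simp_all add: switch_pair_mem simple_apply_switch degree_apply_switch)
    show "adj ?K s t \<longleftrightarrow> adj A s t" if "s \<notin> U" for s t
      using that z U by (auto simp: adj_apply_switch doubleton_eq_iff)
    have new: "adj ?K v t \<longleftrightarrow> t \<noteq> p \<and> (t = q \<or> adj A v t)" for t
      using z(2) by (auto simp: adj_apply_switch doubleton_eq_iff switchable_def)
    have "p \<notin> {t. adj ?K v t \<noteq> adj B v t}" "p \<in> {t. adj A v t \<noteq> adj B v t}"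
      using p by (simp_all add: new)
    moreover have "{t. adj ?K v t \<noteq> adj B v t} \<subseteq> {t. adj A v t \<noteq> adj B v t}"
      using p q by (auto simp: new)
    ultimately show "{t. adj ?K v t \<noteq> adj B v t} \<subset> {t. adj A v t \<noteq> adj B v t}" by blast
  qed simp
qed

lemma card_neighbours_eq_if_agree_outside:
  assumes "simple_graph G" "simple_graph H" "degree G t = degree H t"
    and "\<And>s. s \<notin> U \<Longrightarrow> adj G t s \<longleftrightarrow> adj H t s"
  shows "card {s \<in> U. adj G t s} = card {s \<in> U. adj H t s}"
proof -
  have split: "card {s. adj K t s} = card {s \<in> U. adj K t s} + card {s. s \<notin> U \<and> adj K t s}"
    if "simple_graph K" for K
    using finite_neighbours[OF that, of t]
    by (subst card_Un_disjoint[symmetric]) (auto intro!: arg_cong[where f = card] elim: rev_finite_subset)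
  have "{s. s \<notin> U \<and> adj G t s} = {s. s \<notin> U \<and> adj H t s}" using assms(4) by auto
  with split[OF assms(1)] split[OF assms(2)] assms show ?thesis
    by (simp add: degree_eq_card_neighbours)
qed

text \<open>The set \<open>U\<close> contains all vertices at which the two graphs may still differ. One vertex \<open>v\<close> of \<open>U\<close> is
settled at a time, by exchanges that bring its two neighbourhoods closer together and do not
disturb the vertices settled before. Restricting attention to edges within \<open>U\<close> replaces the
deletion of settled vertices.\<close>

lemma switch_connected_within:
  assumes "finite U" "simple_graph G" "simple_graph H" "verts G = verts H"
    and "\<And>t. degree G t = degree H t"
    and "\<And>s t. s \<notin> U \<Longrightarrow> adj G s t \<longleftrightarrow> adj H s t"
  shows "switch_step\<^sup>*\<^sup>* G H"
  using assms
proof (induction U arbitrary: G H rule: finite_induct)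
  case empty
  then show ?case using graph_eqI[of G H] by auto
next
  case (insert v U)
  define diff where "diff G H = {t. adj G v t \<noteq> adj H v t}" for G H :: "'a sgraph"
  let ?W = "insert v U"
  from insert.prems show ?case
  proof (induction "card (diff G H)" arbitrary: G H rule: less_induct)
    case less
    note G = less.prems(1) and H = less.prems(2)
    have outside: "adj G s t \<longleftrightarrow> adj H s t" if "s \<notin> ?W \<or> t \<notin> ?W" for s t
      using that less.prems(5) by (metis adj_commute)
    have finite_diff: "finite (diff G H)"
      by (rule finite_subset[of _ "{t. adj G v t} \<union> {t. adj H v t}"])
        (auto simp: diff_def finite_neighbours G H)
    have local_degree: "card {s \<in> ?W. adj G t s} = card {s \<in> ?W. adj H t s}" for t
      by (rule card_neighbours_eq_if_agree_outside[OF G H less.prems(4)]) (simp add: outside)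
    show ?case
    proof (cases "diff G H = {}")
      case True
      then have "adj G s t \<longleftrightarrow> adj H s t" if "s \<notin> U" for s t
        using that outside[of s t] by (cases "s = v") (auto simp: diff_def)
      then show ?thesis using insert.IH[OF G H less.prems(3,4)] by blast
    next
      case False
      let ?P = "{t. adj G v t}" and ?Q = "{t. adj H v t}"
      have fin: "finite ?P" "finite ?Q" by (simp_all add: finite_neighbours G H)
      have "card ?P = card ?Q"
        using less.prems(4)[of v] by (simp add: degree_eq_card_neighbours G H)
      then have "card (?P - ?Q) = card (?Q - ?P)"
        using fin by (intro antisym card_le_sym_Diff) simp_all
      then have "?P - ?Q = {} \<longleftrightarrow> ?Q - ?P = {}"
        using fin by (metis card_0_eq finite_Diff)
      moreover have "diff G H = (?P - ?Q) \<union> (?Q - ?P)" by (auto simp: diff_def)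
      ultimately obtain u w where u: "adj G v u" "\<not> adj H v u" and w: "adj H v w" "\<not> adj G v w"
        using False by blast
      have U: "u \<in> ?W" "w \<in> ?W" "u \<noteq> v" "w \<noteq> v"
        using u w outside adjD(3)[OF G] adjD(3)[OF H] by blast+
      show ?thesis
      \<comment> \<open>Both graphs give \<open>u\<close> and \<open>w\<close> the same degrees within \<open>?W\<close>. If \<open>w\<close> has at least the degree
        of \<open>u\<close>, the exchange is possible in \<open>G\<close>; otherwise the reverse exchange is possible in \<open>H\<close>,
        and reversibility of switches closes the chain.\<close>
      proof (cases "card {z \<in> ?W. adj G u z} \<le> card {z \<in> ?W. adj G w z}")
        case True
        obtain K where K: "switch_step G K" "simple_graph K" "verts K = verts G"
            "\<And>t. degree K t = degree G t" "\<And>s t. s \<notin> ?W \<Longrightarrow> adj K s t \<longleftrightarrow> adj G s t"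
            "diff K H \<subset> diff G H"
          unfolding diff_def
          by (rule switch_step_closer[OF G _ _ U(1,2) u w(2,1) U(4) True]) (use insert.hyps in auto)
        have "switch_step\<^sup>*\<^sup>* K H"
          by (rule less.hyps[OF psubset_card_mono[OF finite_diff K(6)] K(2) H])
            (simp_all add: K less.prems)
        with K(1) show ?thesis by (rule converse_rtranclp_into_rtranclp)
      next
        case False
        then have le: "card {z \<in> ?W. adj H w z} \<le> card {z \<in> ?W. adj H u z}"
          by (simp only: local_degree)
        obtain K where K: "switch_step H K" "simple_graph K" "verts K = verts H"
            "\<And>t. degree K t = degree H t" "\<And>s t. s \<notin> ?W \<Longrightarrow> adj K s t \<longleftrightarrow> adj H s t"
            "{t. adj K v t \<noteq> adj G v t} \<subset> {t. adj H v t \<noteq> adj G v t}"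
          by (rule switch_step_closer[OF H _ _ U(2,1) w u(2,1) U(3) le]) (use insert.hyps in auto)
        then have "diff G K \<subset> diff G H" unfolding diff_def by (simp add: eq_commute)
        then have "switch_step\<^sup>*\<^sup>* G K"
          by (intro less.hyps[OF psubset_card_mono[OF finite_diff] G K(2)])
            (simp_all add: K less.prems)
        then show ?thesis using switch_step_sym[OF K(1)] by (rule rtranclp.rtrancl_into_rtrancl)
      qed
    qed
  qed
qed

lemma switch_connected:
  assumes "simple_graph G" "simple_graph H" "verts G = verts H"
    and "\<And>t. t \<in> verts G \<Longrightarrow> degree G t = degree H t"
  shows "switch_step\<^sup>*\<^sup>* G H"
proof (rule switch_connected_within)
  show "finite (verts G)" using assms(1) by (simp add: simple_graph_def)
  have "degree K t = 0" if "simple_graph K" "t \<notin> verts K" for K :: "'a sgraph" and t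
    using that adjD(1)[OF that(1)] by (auto simp: degree_eq_card_neighbours card_eq_0_iff)
  then show "degree G t = degree H t" for t using assms by (cases "t \<in> verts G") auto
  show "adj G s t \<longleftrightarrow> adj H s t" if "s \<notin> verts G" for s t
    using that assms(3) adjD(1)[OF assms(1)] adjD(1)[OF assms(2)] by auto
qed (use assms in auto)

section \<open>Relabelling\<close>

definition relabel :: "('a \<Rightarrow> 'b) \<Rightarrow> 'a sgraph \<Rightarrow> 'b sgraph" where
  "relabel f G = (f ` verts G, (`) f ` edges G)"

lemma verts_relabel [simp]: "verts (relabel f G) = f ` verts G"
  by (simp add: relabel_def)

lemma simple_relabel:
  assumes G: "simple_graph G" and inj: "inj_on f (verts G)"
  shows "simple_graph (relabel f G)"
proof -
  have "card (f ` e) = 2" if "e \<in> edges G" for e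
    using that G inj_on_subset[OF inj] by (simp add: simple_graph_def card_image)
  with G show ?thesis by (auto simp: simple_graph_def relabel_def)
qed

lemma relabel_iso:
  assumes G: "simple_graph G" and inj: "inj_on f (verts G)"
  shows "graph_iso f G (relabel f G)"
proof (rule graph_isoI)
  show "bij_betw f (verts G) (verts (relabel f G))" using inj by (simp add: bij_betw_def)
  fix u v assume uv: "u \<in> verts G" "v \<in> verts G"
  have "{f u, f v} \<in> (`) f ` edges G \<longleftrightarrow> {u, v} \<in> edges G"
  proof
    assume "{f u, f v} \<in> (`) f ` edges G"
    then obtain e where e: "e \<in> edges G" "f ` {u, v} = f ` e" by auto
    moreover have "e \<subseteq> verts G" using e(1) G by (simp add: simple_graph_def)
    ultimately show "{u, v} \<in> edges G"
      using inj_on_image_eq_iff[OF inj, of "{u, v}" e] uv by simp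
  next
    assume "{u, v} \<in> edges G"
    then have "f ` {u, v} \<in> (`) f ` edges G" by (rule imageI)
    then show "{f u, f v} \<in> (`) f ` edges G" by simp
  qed
  then show "adj (relabel f G) (f u) (f v) \<longleftrightarrow> adj G u v"
    by (simp add: adj_def relabel_def)
qed

lemma relabel_inverse:
  assumes "\<And>v. g (f v) = v"
  shows "relabel g (relabel f G) = G"
  using assms by (simp add: relabel_def image_image prod_eq_iff)

lemma switch_step_relabel:
  assumes inj: "inj f" and "switch_step G H"
  shows "switch_step (relabel f G) (relabel f H)"
proof -
  obtain a b x y where sw: "switchable G a b x y" and H: "H = apply_switch (switch_pair a b x y) G"
    using assms(2) by (auto simp: switch_step_def elim: two_switchesE)
  have "inj ((`) f)" using inj by (simp add: inj_image_eq_iff inj_def)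
  then have adj: "adj (relabel f G) (f u) (f v) \<longleftrightarrow> adj G u v" for u v
    using inj_image_mem_iff[of "(`) f" "{u, v}" "edges G"] by (simp add: adj_def relabel_def)
  have "switchable (relabel f G) (f a) (f b) (f x) (f y)"
    using sw inj by (auto simp: switchable_def adj inj_eq)
  moreover have "relabel f H = apply_switch (switch_pair (f a) (f b) (f x) (f y)) (relabel f G)"
    using image_set_diff[OF \<open>inj ((`) f)\<close>, of "edges G" "{{a, b}, {x, y}}"]
    by (simp add: H relabel_def apply_switch_def switch_pair_def image_Un)
  ultimately show ?thesis by (auto simp: switch_step_def switch_pair_mem)
qed

section \<open>Realization graphs\<close>

lemma labeled_realizationsD:
  assumes "G \<in> labeled_realizations d"
  shows "simple_graph G" "verts G = {1..length d}"
    "i \<in> {1..length d} \<Longrightarrow> degree G i = d ! (i - 1)"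
  using assms by (auto simp: labeled_realizations_def)

lemma finite_labeled_realizations: "finite (labeled_realizations d)"
proof (rule finite_subset)
  show "labeled_realizations d \<subseteq> {{1..length d}} \<times> Pow (Pow {1..length d})"
  proof
    fix G assume "G \<in> labeled_realizations d"
    from labeled_realizationsD(1,2)[OF this]
    show "G \<in> {{1..length d}} \<times> Pow (Pow {1..length d})"
      by (metis PowI SigmaI prod.collapse simple_graph_def singletonI subsetI)
  qed
qed simp

lemma labeled_realizations_apply_switch:
  assumes "G \<in> labeled_realizations d" "\<tau> \<in> two_switches G"
  shows "apply_switch \<tau> G \<in> labeled_realizations d"
  using assms by (simp add: labeled_realizations_def simple_apply_switch degree_apply_switch)

lemma labeled_realizations_connected:
  assumes "G \<in> labeled_realizations d" "H \<in> labeled_realizations d"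
  shows "switch_step\<^sup>*\<^sup>* G H"
  using labeled_realizationsD[OF assms(1)] labeled_realizationsD[OF assms(2)]
  by (intro switch_connected) auto

lemma labeled_copy:
  assumes "realizes G d"
  obtains H where "H \<in> labeled_realizations d" "graph_isomorphic G H"
proof -
  obtain f where G: "simple_graph G" and bij: "bij_betw f {1..length d} (verts G)"
    and deg: "\<And>i. i \<in> {1..length d} \<Longrightarrow> degree G (f i) = d ! (i - 1)"
    using assms by (auto simp: realizes_def)
  define g where "g = inv_into {1..length d} f"
  have g: "bij_betw g (verts G) {1..length d}"
    unfolding g_def using bij by (rule bij_betw_inv_into)
  then have inj: "inj_on g (verts G)" by (simp add: bij_betw_def)
  have "degree (relabel g G) i = d ! (i - 1)" if "i \<in> {1..length d}" for i
  proof -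
    have "f i \<in> verts G" "g (f i) = i"
      using bij that by (auto simp: g_def bij_betw_def)
    then show ?thesis
      using degree_graph_iso[OF G simple_relabel[OF G inj] relabel_iso[OF G inj]] deg[OF that] by metis
  qed
  then have "relabel g G \<in> labeled_realizations d"
    using g simple_relabel[OF G inj] by (simp add: labeled_realizations_def bij_betw_def)
  moreover have "graph_isomorphic G (relabel g G)"
    using relabel_iso[OF G inj] by (auto simp: graph_isomorphic_def)
  ultimately show thesis by (rule that)
qed

lemma verts_realization_graph [simp]: "verts (realization_graph d) = labeled_realizations d"
  by (simp add: realization_graph_def)

lemma edges_realization_graph:
  "e \<in> edges (realization_graph d) \<longleftrightarrow>
     (\<exists>G\<in>labeled_realizations d. \<exists>H\<in>labeled_realizations d. e = {G, H} \<and> switch_step G H)"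
  unfolding realization_graph_def switch_step_def snd_conv by blast

lemma adj_realization_graph:
  "adj (realization_graph d) G H \<longleftrightarrow>
     G \<in> labeled_realizations d \<and> H \<in> labeled_realizations d \<and> switch_step G H"
  unfolding adj_def edges_realization_graph doubleton_eq_iff
  by (metis switch_step_sym)

text \<open>Different switches lead to different graphs, since the deleted and added edges can be read off
from the result. So the neighbours of a graph in the realization graph are counted by its switches.\<close>

lemma apply_switch_determines_switch:
  assumes "\<tau> \<in> two_switches G"
  shows "\<tau> = (edges G - edges (apply_switch \<tau> G), edges (apply_switch \<tau> G) - edges G)"
  using assms
proof (rule two_switchesE)
  fix a b x y assume \<tau>: "\<tau> = switch_pair a b x y" "switchable G a b x y"
  then have "fst \<tau> \<subseteq> edges G" "snd \<tau> \<inter> edges G = {}"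
    by (auto simp: switch_pair_def switchable_def adj_def)
  then show ?thesis by (auto simp: apply_switch_def prod_eq_iff)
qed

lemma switch_step_irrefl: "\<not> switch_step G G"
proof
  assume "switch_step G G"
  then obtain \<tau> where "\<tau> \<in> two_switches G" "G = apply_switch \<tau> G" by (auto simp: switch_step_def)
  then have "\<tau> = ({}, {})" using apply_switch_determines_switch by fastforce
  with \<open>\<tau> \<in> two_switches G\<close> show False by (auto simp: two_switches_def)
qed

lemma simple_realization_graph:
  assumes "labeled_realizations d \<noteq> {}"
  shows "simple_graph (realization_graph d)"
proof -
  have "e \<subseteq> labeled_realizations d \<and> card e = 2" if e: "e \<in> edges (realization_graph d)" for e
  proof -
    obtain G H where "e = {G, H}" "G \<in> labeled_realizations d" "H \<in> labeled_realizations d"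
      "switch_step G H" using e unfolding edges_realization_graph by blast
    moreover from this have "G \<noteq> H" using switch_step_irrefl by blast
    ultimately show ?thesis by simp
  qed
  with assms show ?thesis by (simp add: simple_graph_def finite_labeled_realizations)
qed

lemma degree_realization_graph:
  assumes "G \<in> labeled_realizations d"
  shows "degree (realization_graph d) G = switch_degree G"
proof -
  have "inj_on (\<lambda>\<tau>. apply_switch \<tau> G) (two_switches G)"
    by (rule inj_onI) (metis apply_switch_determines_switch)
  moreover have "{H. adj (realization_graph d) G H} = (\<lambda>\<tau>. apply_switch \<tau> G) ` two_switches G"
    using assms labeled_realizations_apply_switch[OF assms]
    unfolding adj_realization_graph switch_step_def by blast
  moreover have "simple_graph (realization_graph d)"
    using assms simple_realization_graph by blast
  ultimately show ?thesis by (simp add: degree_eq_card_neighbours card_image switch_degree_def)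
qed

lemma relabel_labeled_realization:
  assumes \<sigma>: "\<sigma> permutes {1..length d}"
    and d: "\<And>i. i \<in> {1..length d} \<Longrightarrow> d ! (\<sigma> i - 1) = d ! (i - 1)"
    and G: "G \<in> labeled_realizations d"
  shows "relabel \<sigma> G \<in> labeled_realizations d"
proof -
  note G = labeled_realizationsD[OF G]
  have inj: "inj_on \<sigma> (verts G)" using permutes_inj_on[OF \<sigma>] .
  have "degree (relabel \<sigma> G) j = d ! (j - 1)" if j: "j \<in> {1..length d}" for j
  proof -
    obtain i where i: "i \<in> {1..length d}" "j = \<sigma> i"
      using j permutes_image[OF \<sigma>] by blast
    have "degree (relabel \<sigma> G) (\<sigma> i) = degree G i"
      by (rule degree_graph_iso[OF G(1) simple_relabel[OF G(1) inj] relabel_iso[OF G(1) inj]])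
        (simp only: G(2) i(1))
    then show ?thesis by (simp only: G(3)[OF i(1)] d[OF i(1)] i(2))
  qed
  then show ?thesis
    using simple_relabel[OF G(1) inj] G(2) permutes_image[OF \<sigma>] by (simp add: labeled_realizations_def)
qed

lemma relabel_automorphism:
  assumes \<sigma>: "\<sigma> permutes {1..length d}"
    and d: "\<And>i. i \<in> {1..length d} \<Longrightarrow> d ! (\<sigma> i - 1) = d ! (i - 1)"
  shows "graph_iso (relabel \<sigma>) (realization_graph d) (realization_graph d)"
proof -
  have d': "d ! (inv \<sigma> i - 1) = d ! (i - 1)" if "i \<in> {1..length d}" for i
    using d[of "inv \<sigma> i"] permutes_in_image[OF permutes_inv[OF \<sigma>], of i] that permutes_inverses(1)[OF \<sigma>]
    by simp
  have inverse: "relabel (inv \<sigma>) (relabel \<sigma> G) = G" "relabel \<sigma> (relabel (inv \<sigma>) G) = G" for G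
    by (rule relabel_inverse, simp add: permutes_inverses[OF \<sigma>])+
  have into: "relabel \<sigma> G \<in> labeled_realizations d" "relabel (inv \<sigma>) G \<in> labeled_realizations d"
    if "G \<in> labeled_realizations d" for G
    using relabel_labeled_realization[OF \<sigma> d that]
      relabel_labeled_realization[OF permutes_inv[OF \<sigma>] d' that] by blast+
  have "switch_step (relabel \<sigma> G) (relabel \<sigma> H) \<longleftrightarrow> switch_step G H" for G H
    using switch_step_relabel[OF permutes_inj[OF \<sigma>], of G H] inverse
      switch_step_relabel[OF permutes_inj[OF permutes_inv[OF \<sigma>]], of "relabel \<sigma> G" "relabel \<sigma> H"]
    by auto
  moreover have "bij_betw (relabel \<sigma>) (labeled_realizations d) (labeled_realizations d)"
    by (rule bij_betwI[where g = "relabel (inv \<sigma>)"]) (use into inverse in auto)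
  ultimately show ?thesis by (intro graph_isoI) (auto simp: adj_realization_graph into)
qed

text \<open>An isomorphism between two labelled realizations maps each label to one with the same prescribed
degree, so relabelling by it maps the set of all realizations to itself and commutes with switches.\<close>

lemma vertex_transitive_if_all_isomorphic:
  assumes iso: "\<And>G H. G \<in> labeled_realizations d \<Longrightarrow> H \<in> labeled_realizations d \<Longrightarrow> graph_isomorphic G H"
  shows "vertex_transitive (realization_graph d)"
  unfolding vertex_transitive_def verts_realization_graph
proof (intro ballI)
  fix G H assume GH: "G \<in> labeled_realizations d" "H \<in> labeled_realizations d"
  note G = labeled_realizationsD[OF GH(1)] and H = labeled_realizationsD[OF GH(2)]
  obtain f where f: "graph_iso f G H" using iso[OF GH] by (auto simp: graph_isomorphic_def)
  \<comment> \<open>Extending by the identity makes the isomorphism injective on all of \<^typ>\<open>nat\<close>, so that it acts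
    on arbitrary sets of edges and has a global inverse.\<close>
  define \<sigma> where "\<sigma> i = (if i \<in> {1..length d} then f i else i)" for i
  have "bij_betw f {1..length d} {1..length d}" using f G H by (simp add: graph_iso_def)
  then have "bij_betw \<sigma> {1..length d} {1..length d}"
    by (rule bij_betw_cong[THEN iffD1, rotated]) (simp add: \<sigma>_def)
  then have \<sigma>: "\<sigma> permutes {1..length d}" by (rule bij_imp_permutes) (auto simp: \<sigma>_def)
  have \<sigma>_iso: "graph_iso \<sigma> G H"
    using graph_iso_adj[OF f] \<open>bij_betw \<sigma> _ _\<close> G(2) H(2)
    by (intro graph_isoI) (simp_all add: \<sigma>_def)
  have "d ! (\<sigma> i - 1) = d ! (i - 1)" if "i \<in> {1..length d}" for i
    using degree_graph_iso[OF G(1) H(1) \<sigma>_iso, of i] G(2,3) H(3) that permutes_in_image[OF \<sigma>, of i] by simp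
  then have "graph_iso (relabel \<sigma>) (realization_graph d) (realization_graph d)"
    by (rule relabel_automorphism[OF \<sigma>])
  moreover have "relabel \<sigma> G = H"
  proof (rule graph_eqI)
    have inj: "inj_on \<sigma> (verts G)" using permutes_inj_on[OF \<sigma>] .
    show R: "simple_graph (relabel \<sigma> G)" by (rule simple_relabel[OF G(1) inj])
    show V: "verts (relabel \<sigma> G) = verts H" using permutes_image[OF \<sigma>] G(2) H(2) by simp
    show "adj (relabel \<sigma> G) u v \<longleftrightarrow> adj H u v" for u v
    proof (cases "u \<in> \<sigma> ` verts G \<and> v \<in> \<sigma> ` verts G")
      case True
      then show ?thesis using graph_iso_adj[OF relabel_iso[OF G(1) inj]] graph_iso_adj[OF \<sigma>_iso] by auto
    next
      case False
      then show ?thesis using adjD(1,2)[OF R] adjD(1,2)[OF H(1)] V by auto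
    qed
  qed (rule H(1))
  ultimately show "\<exists>F. graph_iso F (realization_graph d) (realization_graph d) \<and> F G = H" by blast
qed

text \<open>Having few switches and avoiding the two graphs are isomorphism invariants, so the hypotheses of
\<open>apply_switch_isomorphic\<close> persist along a whole chain of switches starting at \<open>G\<close>.\<close>

lemma all_isomorphic_if_no_T221:
  assumes G: "G \<in> labeled_realizations d" and deg: "switch_degree G \<le> 3"
    and T: "\<not> has_induced G T221" "\<not> has_induced G (complement_graph T221)"
    and H: "H \<in> labeled_realizations d"
  shows "graph_isomorphic G H"
proof -
  note simple_G = labeled_realizationsD(1)[OF G]
  have "switch_step\<^sup>*\<^sup>* G H" using G H by (rule labeled_realizations_connected)
  then have "simple_graph H \<and> graph_isomorphic G H"
  proof induction
    case base
    show ?case using simple_G graph_isomorphic_refl by blast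
  next
    case (step K L)
    then have K: "simple_graph K" "graph_isomorphic G K" by auto
    obtain \<tau> where \<tau>: "\<tau> \<in> two_switches K" "L = apply_switch \<tau> K"
      using step.hyps(2) by (auto simp: switch_step_def)
    have "\<not> has_induced K T221" "\<not> has_induced K (complement_graph T221)"
      using T has_induced_isomorphic[OF graph_isomorphic_sym[OF K(2)]] by blast+
    moreover have "switch_degree K \<le> 3"
      using deg switch_degree_isomorphic[OF simple_G K] by simp
    ultimately have "graph_isomorphic L K"
      unfolding \<tau>(2) using K(1) \<tau>(1) by (intro apply_switch_isomorphic)
    then show ?case
      using simple_apply_switch[OF K(1) \<tau>(1)] K(2) graph_isomorphic_sym graph_isomorphic_trans \<tau>(2) by blast
  qed
  then show ?thesis by blast
qed

section \<open>Regularity of the realization graph\<close>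

theorem corollary7p3:
  fixes X :: "'a sgraph" and d :: "nat list" and k :: nat
  assumes "realizes X d"
    and "switch_degree X = k"
    and "k \<le> 3"
  shows "(regular_graph (realization_graph d) \<longleftrightarrow>
            \<not> has_induced X T221 \<and> \<not> has_induced X (complement_graph T221)) \<and>
         (regular_graph (realization_graph d) \<longrightarrow>
            unigraphical d \<and>
            vertex_transitive (realization_graph d) \<and>
            k_regular k (realization_graph d) \<and>
            (\<forall>\<tau>\<in>two_switches X. graph_isomorphic (apply_switch \<tau> X) X))"
proof -
  let ?R = "realization_graph d"
  have X: "simple_graph X" using assms(1) by (simp add: realizes_def)
  \<comment> \<open>The vertices of \<open>X\<close> carry no labels, so \<open>X\<close> itself need not be a vertex of the realization
    graph; a labelled copy takes its place.\<close>
  obtain Y where Y: "Y \<in> labeled_realizations d" and XY: "graph_isomorphic X Y"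
    using assms(1) by (rule labeled_copy)
  have simple_Y: "simple_graph Y" using Y by (rule labeled_realizationsD)
  have deg_Y: "switch_degree Y = k" using switch_degree_isomorphic[OF X simple_Y XY] assms(2) by simp
  let ?free = "\<not> has_induced X T221 \<and> \<not> has_induced X (complement_graph T221)"
  have free: "unigraphical d \<and> vertex_transitive ?R \<and> k_regular k ?R \<and>
      (\<forall>\<tau>\<in>two_switches X. graph_isomorphic (apply_switch \<tau> X) X)" if ?free
  proof -
    have T: "\<not> has_induced Y T221" "\<not> has_induced Y (complement_graph T221)"
      using that has_induced_isomorphic[OF graph_isomorphic_sym[OF XY]] by blast+
    have iso: "graph_isomorphic Y Z" if "Z \<in> labeled_realizations d" for Z
      using all_isomorphic_if_no_T221[OF Y _ T that] deg_Y assms(3) by simp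
    have "unigraphical d"
      unfolding unigraphical_def
      by (metis iso labeled_copy graph_isomorphic_sym graph_isomorphic_trans)
    moreover have "vertex_transitive ?R"
      using iso graph_isomorphic_sym graph_isomorphic_trans
      by (intro vertex_transitive_if_all_isomorphic) blast
    moreover have "k_regular k ?R"
      using switch_degree_isomorphic[OF simple_Y _ iso] deg_Y labeled_realizationsD(1)
      by (auto simp: k_regular_def degree_realization_graph)
    moreover have "graph_isomorphic (apply_switch \<tau> X) X" if "\<tau> \<in> two_switches X" for \<tau>
      using apply_switch_isomorphic[OF X] \<open>?free\<close> that assms by simp
    ultimately show ?thesis by blast
  qed
  moreover have "?free" if regular: "regular_graph ?R"
  proof (rule ccontr)
    assume "\<not> ?free"
    then have "has_induced Y T221 \<or> has_induced Y (complement_graph T221)"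
      using has_induced_isomorphic[OF XY] by blast
    then obtain \<tau> where \<tau>: "\<tau> \<in> two_switches Y" "4 \<le> switch_degree (apply_switch \<tau> Y)"
      using T221_switch_increases_degree[OF simple_Y]
        complement_T221_switch_increases_degree[OF simple_Y] by blast
    have Z: "apply_switch \<tau> Y \<in> labeled_realizations d"
      using Y \<tau>(1) by (rule labeled_realizations_apply_switch)
    have "degree ?R Y = degree ?R (apply_switch \<tau> Y)"
      using regular Y Z by (auto simp: regular_graph_def k_regular_def)
    then show False
      using \<tau>(2) deg_Y assms(3) by (simp add: degree_realization_graph[OF Y] degree_realization_graph[OF Z])
  qed
  ultimately show ?thesis by (auto simp: regular_graph_def)
qed

end
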